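(* Let $\mathcal{X}$ be a category and $\mathcal{M}$ a class of morphisms of $\mathcal{X}$ such that $\mathcal{X}$ has quasi right $\mathcal{M}$-factorizations. If $\mathbf{C}$ is a quasi idempotent closure operator on $\mathcal{X}$ with respect to $\mathcal{M}$, then $\mathcal{X}$ has quasi right $\mathcal{M}^{QC}$-factorizations, where $\mathcal{M}^{QC}$ is the class of quasi $\mathbf{C}$-closed members of $\mathcal{M}$.
   Context: For a class $\mathcal{M}$ of morphisms and an object $X$, $\mathcal{M}/X$ is the class of all morphisms in $\mathcal{M}$ with codomain $X$. For a morphism $f$, $\langle f\rangle=\{fh : h\in\mathcal{X},\ fh\text{ defined}\}$. For morphisms $f,g$ with the same codomain, $f\leqslant g$ means $\langle f\rangle\subseteq\langle g\rangle$ (equivalently $f=gj$ for some $j$), and $f\sim g$ means $f\leqslant g$ and $g\leqslant f$. $\mathcal{X}$ has quasi right $\mathcal{M}$-factorizations if for every morphism $f:Y\to X$ there is $m_f\in\mathcal{M}/X$ (called a quasi right part of $f$) such that (a) $f=m_fg$ for some $g$; (b) if $m\in\mathcal{M}/X$ and $f=mg$ for some $g$, then $m_f=mh$ for some $h$. A quasi right part is determined up to $\sim$. The same definition applies to any class of morphisms in place of $\mathcal{M}$. A (general) closure operator $\mathbf{C}=(\mathbf{c}_X)_{X\in\mathcal{X}}$ on $\mathcal{X}$ with respect to $\mathcal{M}$ (where $\mathcal{X}$ has quasi right $\mathcal{M}$-factorizations) is a family of maps $\mathbf{c}_X:\mathcal{M}/X\to\mathcal{M}/X$ such that: (a) $m\leqslant\mathbf{c}_X(m)$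 for all $m\in\mathcal{M}/X$; (b) if $m\leqslant m'$ in $\mathcal{M}/X$ then $\mathbf{c}_X(m)\leqslant\mathbf{c}_X(m')$; (c) for every $f:X\to Y$ and $m\in\mathcal{M}/X$, $m_{f\mathbf{c}_X(m)}\leqslant\mathbf{c}_Y(m_{fm})$. $m\in\mathcal{M}/X$ is quasi $\mathbf{C}$-closed if $\mathbf{c}_X(m)\sim m$. $\mathbf{C}$ is quasi idempotent if $\mathbf{c}_X(\mathbf{c}_X(m))\sim\mathbf{c}_X(m)$ for every object $X$ and every $m\in\mathcal{M}/X$. *)

theory Defs
  imports Main
begin

text \<open>
  A category is given by carrier sets of objects and morphisms over arbitrary types, with
  composition written in the usual order: \<open>g \<cdot> f\<close> is \<open>f\<close> followed by \<open>g\<close>, and only its values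
  on composable pairs matter.  A class of morphisms is a subset of \<open>Mor\<close>.
\<close>

record ('o, 'm) cat =
  Obj :: "'o set"
  Mor :: "'m set"
  Dom :: "'m \<Rightarrow> 'o"
  Cod :: "'m \<Rightarrow> 'o"
  Id :: "'o \<Rightarrow> 'm"
  Comp :: "'m \<Rightarrow> 'm \<Rightarrow> 'm"  (infixl "\<cdot>\<index>" 70)

locale category =
  fixes \<X> :: "('o, 'm) cat" (structure)
  assumes Dom_Obj: "f \<in> Mor \<X> \<Longrightarrow> Dom \<X> f \<in> Obj \<X>"
    and Cod_Obj: "f \<in> Mor \<X> \<Longrightarrow> Cod \<X> f \<in> Obj \<X>"
    and Id_Mor: "X \<in> Obj \<X> \<Longrightarrow> Id \<X> X \<in> Mor \<X>"
    and Dom_Id: "X \<in> Obj \<X> \<Longrightarrow> Dom \<X> (Id \<X> X) = X"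
    and Cod_Id: "X \<in> Obj \<X> \<Longrightarrow> Cod \<X> (Id \<X> X) = X"
    and Comp_Mor: "\<lbrakk>f \<in> Mor \<X>; g \<in> Mor \<X>; Cod \<X> f = Dom \<X> g\<rbrakk> \<Longrightarrow> g \<cdot> f \<in> Mor \<X>"
    and Dom_Comp: "\<lbrakk>f \<in> Mor \<X>; g \<in> Mor \<X>; Cod \<X> f = Dom \<X> g\<rbrakk> \<Longrightarrow> Dom \<X> (g \<cdot> f) = Dom \<X> f"
    and Cod_Comp: "\<lbrakk>f \<in> Mor \<X>; g \<in> Mor \<X>; Cod \<X> f = Dom \<X> g\<rbrakk> \<Longrightarrow> Cod \<X> (g \<cdot> f) = Cod \<X> g"
    and Comp_Id_right: "f \<in> Mor \<X> \<Longrightarrow> f \<cdot> Id \<X> (Dom \<X> f) = f"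
    and Comp_Id_left: "f \<in> Mor \<X> \<Longrightarrow> Id \<X> (Cod \<X> f) \<cdot> f = f"
    and Comp_assoc: "\<lbrakk>f \<in> Mor \<X>; g \<in> Mor \<X>; h \<in> Mor \<X>; Cod \<X> f = Dom \<X> g; Cod \<X> g = Dom \<X> h\<rbrakk>
      \<Longrightarrow> (h \<cdot> g) \<cdot> f = h \<cdot> (g \<cdot> f)"

definition over :: "('o, 'm) cat \<Rightarrow> 'm set \<Rightarrow> 'o \<Rightarrow> 'm set"
  where "over \<X> M X = {m \<in> M. Cod \<X> m = X}"

definition principal :: "('o, 'm) cat \<Rightarrow> 'm \<Rightarrow> 'm set"
  where "principal \<X> f = {f \<cdot>\<^bsub>\<X>\<^esub> h | h. h \<in> Mor \<X> \<and> Cod \<X> h = Dom \<X> f}"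

definition mor_le :: "('o, 'm) cat \<Rightarrow> 'm \<Rightarrow> 'm \<Rightarrow> bool"  (infix "\<lesssim>\<index>" 50)
  where "f \<lesssim>\<^bsub>\<X>\<^esub> g \<longleftrightarrow> f \<in> Mor \<X> \<and> g \<in> Mor \<X> \<and> Cod \<X> f = Cod \<X> g
    \<and> principal \<X> f \<subseteq> principal \<X> g"

definition mor_equiv :: "('o, 'm) cat \<Rightarrow> 'm \<Rightarrow> 'm \<Rightarrow> bool"  (infix "\<sim>\<index>" 50)
  where "f \<sim>\<^bsub>\<X>\<^esub> g \<longleftrightarrow> f \<lesssim>\<^bsub>\<X>\<^esub> g \<and> g \<lesssim>\<^bsub>\<X>\<^esub> f"

definition quasi_right_part :: "('o, 'm) cat \<Rightarrow> 'm set \<Rightarrow> 'm \<Rightarrow> 'm \<Rightarrow> bool"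
  where "quasi_right_part \<X> M f p \<longleftrightarrow>
    p \<in> over \<X> M (Cod \<X> f)
    \<and> (\<exists>g \<in> Mor \<X>. Cod \<X> g = Dom \<X> p \<and> f = p \<cdot>\<^bsub>\<X>\<^esub> g)
    \<and> (\<forall>m \<in> over \<X> M (Cod \<X> f).
         (\<exists>g \<in> Mor \<X>. Cod \<X> g = Dom \<X> m \<and> f = m \<cdot>\<^bsub>\<X>\<^esub> g) \<longrightarrow>
         (\<exists>h \<in> Mor \<X>. Cod \<X> h = Dom \<X> m \<and> p = m \<cdot>\<^bsub>\<X>\<^esub> h))"

definition has_quasi_right_factorizations :: "('o, 'm) cat \<Rightarrow> 'm set \<Rightarrow> bool"
  where "has_quasi_right_factorizations \<X> M \<longleftrightarrow> (\<forall>f \<in> Mor \<X>. \<exists>p. quasi_right_part \<X> M f p)"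

text \<open>
  Quasi right parts are determined only up to \<open>\<sim>\<close>, so the last axiom is stated for all quasi
  right parts \<open>p\<close> of \<open>f \<cdot> c X m\<close> and \<open>q\<close> of \<open>f \<cdot> m\<close>.  Since \<open>c\<close> is monotone, this is
  equivalent to the axiom for one fixed choice of quasi right parts.
\<close>

definition closure_operator :: "('o, 'm) cat \<Rightarrow> 'm set \<Rightarrow> ('o \<Rightarrow> 'm \<Rightarrow> 'm) \<Rightarrow> bool"
  where "closure_operator \<X> M c \<longleftrightarrow>
    (\<forall>X \<in> Obj \<X>. \<forall>m \<in> over \<X> M X. c X m \<in> over \<X> M X)
    \<and> (\<forall>X \<in> Obj \<X>. \<forall>m \<in> over \<X> M X. m \<lesssim>\<^bsub>\<X>\<^esub> c X m)
    \<and> (\<forall>X \<in> Obj \<X>. \<forall>m \<in> over \<X> M X. \<forall>m' \<in> over \<X> M X.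
         m \<lesssim>\<^bsub>\<X>\<^esub> m' \<longrightarrow> c X m \<lesssim>\<^bsub>\<X>\<^esub> c X m')
    \<and> (\<forall>X \<in> Obj \<X>. \<forall>Y \<in> Obj \<X>. \<forall>f \<in> Mor \<X>. Dom \<X> f = X \<and> Cod \<X> f = Y \<longrightarrow>
         (\<forall>m \<in> over \<X> M X. \<forall>p q.
            quasi_right_part \<X> M (f \<cdot>\<^bsub>\<X>\<^esub> c X m) p \<and> quasi_right_part \<X> M (f \<cdot>\<^bsub>\<X>\<^esub> m) q \<longrightarrow>
            p \<lesssim>\<^bsub>\<X>\<^esub> c Y q))"

definition quasi_closed :: "('o, 'm) cat \<Rightarrow> ('o \<Rightarrow> 'm \<Rightarrow> 'm) \<Rightarrow> 'm \<Rightarrow> bool"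
  where "quasi_closed \<X> c m \<longleftrightarrow> c (Cod \<X> m) m \<sim>\<^bsub>\<X>\<^esub> m"

definition quasi_idempotent :: "('o, 'm) cat \<Rightarrow> 'm set \<Rightarrow> ('o \<Rightarrow> 'm \<Rightarrow> 'm) \<Rightarrow> bool"
  where "quasi_idempotent \<X> M c \<longleftrightarrow>
    (\<forall>X \<in> Obj \<X>. \<forall>m \<in> over \<X> M X. c X (c X m) \<sim>\<^bsub>\<X>\<^esub> c X m)"

definition quasi_closed_class :: "('o, 'm) cat \<Rightarrow> 'm set \<Rightarrow> ('o \<Rightarrow> 'm \<Rightarrow> 'm) \<Rightarrow> 'm set"
  where "quasi_closed_class \<X> M c = {m \<in> M. quasi_closed \<X> c m}"

end

theory Submission
  imports Defs
begin

text \<open>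
  In the preorder \<open>\<lesssim>\<close> on the morphisms with a given codomain, \<open>f \<lesssim> g\<close> says that \<open>f\<close> factors
  through \<open>g\<close> (\<open>mor_le_iff_factors\<close>).  A quasi right \<open>M\<close>-part of \<open>f\<close> is therefore a least member
  of \<open>M\<close> above \<open>f\<close> (\<open>quasi_right_part_iff_least\<close>), and the theorem becomes a statement about
  closure operators on preorders: if \<open>p\<close> is a least member of \<open>M\<close> above \<open>f\<close>, then its closure
  is a least closed member of \<open>M\<close> above \<open>f\<close>.  Quasi idempotence makes the closure \<open>c p\<close> closed,
  and \<open>f \<lesssim> p \<lesssim> c p\<close>.  Any closed \<open>m\<close> above \<open>f\<close> satisfies \<open>p \<lesssim> m\<close> because \<open>p\<close> is least in
  \<open>M\<close>, hence \<open>c p \<lesssim> c m \<sim> m\<close> by monotonicity.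
\<close>

lemma mor_le_trans: "f \<lesssim>\<^bsub>\<X>\<^esub> g \<Longrightarrow> g \<lesssim>\<^bsub>\<X>\<^esub> h \<Longrightarrow> f \<lesssim>\<^bsub>\<X>\<^esub> h"
  unfolding mor_le_def by auto

text \<open>
  The inclusion of principal classes reduces to one factorization since \<open>f\<close> itself lies in
  \<open>principal \<X> f\<close>; conversely, associativity carries a factorization of \<open>f\<close> to all \<open>f \<cdot> h\<close>.
\<close>

lemma (in category) mor_le_iff_factors:
  assumes "f \<in> Mor \<X>" and "g \<in> Mor \<X>" and cod: "Cod \<X> f = Cod \<X> g"
  shows "f \<lesssim> g \<longleftrightarrow> (\<exists>j \<in> Mor \<X>. Cod \<X> j = Dom \<X> g \<and> f = g \<cdot> j)"
proof
  assume "f \<lesssim> g"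
  moreover have "f \<in> principal \<X> f"
    unfolding principal_def
    using assms(1) Comp_Id_right[of f, symmetric] Id_Mor Cod_Id Dom_Obj by blast
  ultimately show "\<exists>j \<in> Mor \<X>. Cod \<X> j = Dom \<X> g \<and> f = g \<cdot> j"
    unfolding mor_le_def principal_def by auto
next
  assume "\<exists>j \<in> Mor \<X>. Cod \<X> j = Dom \<X> g \<and> f = g \<cdot> j"
  then obtain j where j: "j \<in> Mor \<X>" "Cod \<X> j = Dom \<X> g" "f = g \<cdot> j"
    by blast
  have "f \<cdot> h \<in> principal \<X> g" if h: "h \<in> Mor \<X>" "Cod \<X> h = Dom \<X> f" for h
  proof -
    have "Cod \<X> h = Dom \<X> j"
      using h j assms(2) Dom_Comp by simp
    then have "f \<cdot> h = g \<cdot> (j \<cdot> h)" "j \<cdot> h \<in> Mor \<X>" "Cod \<X> (j \<cdot> h) = Dom \<X> g"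
      using h j assms(2) by (simp_all add: Comp_assoc Comp_Mor Cod_Comp)
    then show ?thesis
      unfolding principal_def by blast
  qed
  then show "f \<lesssim> g"
    using assms unfolding mor_le_def principal_def[of \<X> f] by blast
qed

lemma (in category) quasi_right_part_iff_least:
  assumes "M \<subseteq> Mor \<X>" and "f \<in> Mor \<X>"
  shows "quasi_right_part \<X> M f p \<longleftrightarrow>
    p \<in> over \<X> M (Cod \<X> f) \<and> f \<lesssim> p \<and> (\<forall>m \<in> over \<X> M (Cod \<X> f). f \<lesssim> m \<longrightarrow> p \<lesssim> m)"
proof -
  have "m \<in> Mor \<X> \<and> Cod \<X> m = Cod \<X> f" if "m \<in> over \<X> M (Cod \<X> f)" for m
    using that assms(1) unfolding over_def by auto
  then show ?thesis
    unfolding quasi_right_part_def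
    using mor_le_iff_factors[OF assms(2)] mor_le_iff_factors[of p]
    by (smt (verit, best))
qed

lemma (in category) quasi_right_part_closure:
  assumes M: "M \<subseteq> Mor \<X>" and f: "f \<in> Mor \<X>"
    and closure: "closure_operator \<X> M c" and idem: "quasi_idempotent \<X> M c"
    and p: "quasi_right_part \<X> M f p"
  shows "quasi_right_part \<X> (quasi_closed_class \<X> M c) f (c (Cod \<X> f) p)"
proof -
  define Y where "Y = Cod \<X> f"
  have Y: "Y \<in> Obj \<X>"
    using f Cod_Obj by (simp add: Y_def)
  have pM: "p \<in> over \<X> M Y" and fp: "f \<lesssim> p"
    and least: "\<And>m. m \<in> over \<X> M Y \<Longrightarrow> f \<lesssim> m \<Longrightarrow> p \<lesssim> m"
    using p quasi_right_part_iff_least[OF M f] unfolding Y_def by blast+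
  have cpM: "c Y p \<in> over \<X> M Y" and pcp: "p \<lesssim> c Y p"
    using closure Y pM unfolding closure_operator_def by blast+
  have mono: "c Y p \<lesssim> c Y m" if "m \<in> over \<X> M Y" "p \<lesssim> m" for m
    using closure Y pM that unfolding closure_operator_def by blast
  have "c Y (c Y p) \<sim> c Y p"
    using idem Y pM unfolding quasi_idempotent_def by blast
  then have cp_closed: "c Y p \<in> over \<X> (quasi_closed_class \<X> M c) Y"
    using cpM unfolding over_def quasi_closed_class_def quasi_closed_def by auto
  have cp_least: "c Y p \<lesssim> m"
    if m: "m \<in> over \<X> (quasi_closed_class \<X> M c) Y" and fm: "f \<lesssim> m" for m
  proof -
    have mM: "m \<in> over \<X> M Y" and "c Y m \<lesssim> m"
      using m unfolding over_def quasi_closed_class_def quasi_closed_def mor_equiv_def by auto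
    moreover have "c Y p \<lesssim> c Y m"
      using mono mM least fm by blast
    ultimately show ?thesis
      by (metis mor_le_trans)
  qed
  have "quasi_closed_class \<X> M c \<subseteq> Mor \<X>"
    using M unfolding quasi_closed_class_def by blast
  then show ?thesis
    using cp_closed cp_least mor_le_trans[OF fp pcp]
    by (simp add: quasi_right_part_iff_least[OF _ f] Y_def)
qed

theorem theorem4p4:
  fixes \<X> :: "('o, 'm) cat" and M :: "'m set" and c :: "'o \<Rightarrow> 'm \<Rightarrow> 'm"
  assumes "category \<X>"
    and "M \<subseteq> Mor \<X>"
    and "has_quasi_right_factorizations \<X> M"
    and "closure_operator \<X> M c"
    and "quasi_idempotent \<X> M c"
  shows "has_quasi_right_factorizations \<X> (quasi_closed_class \<X> M c)"
  using assms(3) category.quasi_right_part_closure[OF assms(1,2) _ assms(4,5)]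
  unfolding has_quasi_right_factorizations_def by blast

end
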